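(* Let $M \in \mathcal{S}_n$ be a singular maximizer of $C_3$. The following conditions are equivalent: (i) $M$ is a trivial singular maximizer of $C_3$; (ii) $M$ is obtained by adding a source or a sink to a regular or almost regular tournament of order $n-1$; (iii) $M$ has a strongly connected component of order $1$.
   Context: A tournament of order $n$ is an orientation of the complete graph on $n$ vertices; a tournament matrix of order $n$ is its adjacency matrix, i.e. an $n \times n$ $(0,1)$-matrix $M$ with $M + M^T = J_n - I_n$ ($J_n$ all-ones, $I_n$ identity). Tournaments and their matrices are identified. $\mathcal{S}_n$ is the set of singular tournament matrices of order $n$ (over the real/complex numbers). $C_3(M)$ is the number of directed $3$-cycles of $M$, counted as $3$-vertex subsets inducing a directed cycle. A matrix $M \in \mathcal{S}_n$ is a singular maximizer of $C_3$ if $C_3(M) = \max_{N \in \mathcal{S}_n} C_3(N)$. A singular maximizer of $C_3$ of order $n$ is called trivial if it is obtained by adding a vertex (with arbitrary arcs between the new vertex and the old ones) to a regular or almost regular tournament of order $n-1$. A tournament is regular if all its vertices have the same outdegree (its order is then odd); a tournament of order $m$ is almost regular if the maximum difference of outdegrees between its vertices is $1$ (its order $m$ is then even, with $m/2$ vertices of outdegree $m/2-1$ and $m/2$ of outdegree $m/2$). A sink is a vertex beaten by all other vertices; a source is a vertex that beats all other vertices. The strongly connected components of $M$ are the subtournaments induced on the equivalence classes of vertices under the relation "there is a directed walk from $u$ to $v$ and a directed walk from $v$ to $u$". *)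

theory Defs
  imports "Jordan_Normal_Form.Determinant"
begin

definition all_ones_mat :: "nat \<Rightarrow> real mat" where
  "all_ones_mat n = mat n n (\<lambda>_. 1)"

definition tournament_mats :: "nat \<Rightarrow> real mat set" where
  "tournament_mats n =
     {M \<in> carrier_mat n n. (\<forall>i<n. \<forall>j<n. M $$ (i, j) \<in> {0, 1}) \<and>
        M + transpose_mat M = all_ones_mat n - 1\<^sub>m n}"

definition singular_tournament_mats :: "nat \<Rightarrow> real mat set" where
  "singular_tournament_mats n = {M \<in> tournament_mats n. det M = 0}"

definition arcs :: "real mat \<Rightarrow> (nat \<times> nat) set" where
  "arcs M = {(u, v). u < dim_row M \<and> v < dim_col M \<and> M $$ (u, v) = 1}"

definition C3 :: "real mat \<Rightarrow> nat" where
  "C3 M = card {S. S \<subseteq> {..<dim_row M} \<and> card S = 3 \<and>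
     (\<exists>u v w. S = {u, v, w} \<and> (u, v) \<in> arcs M \<and> (v, w) \<in> arcs M \<and> (w, u) \<in> arcs M)}"

definition singular_maximizer :: "nat \<Rightarrow> real mat \<Rightarrow> bool" where
  "singular_maximizer n M \<longleftrightarrow>
     M \<in> singular_tournament_mats n \<and> C3 M = Max (C3 ` singular_tournament_mats n)"

definition outdegree :: "real mat \<Rightarrow> nat \<Rightarrow> nat" where
  "outdegree M u = card {v. (u, v) \<in> arcs M}"

text \<open>The empty tournament (order 0) counts as regular.\<close>

definition regular_tournament :: "nat \<Rightarrow> real mat \<Rightarrow> bool" where
  "regular_tournament m N \<longleftrightarrow>
     N \<in> tournament_mats m \<and> (\<forall>u<m. \<forall>v<m. outdegree N u = outdegree N v)"

definition almost_regular_tournament :: "nat \<Rightarrow> real mat \<Rightarrow> bool" where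
  "almost_regular_tournament m N \<longleftrightarrow>
     N \<in> tournament_mats m \<and> 0 < m \<and>
     Max ((\<lambda>(u, v). int (outdegree N u) - int (outdegree N v)) ` ({..<m} \<times> {..<m})) = 1"

text \<open>\<open>M\<close> arises from \<open>N\<close> by adding a new vertex, which receives the label \<open>v\<close>; the other
  vertices keep their relative order. The arcs at \<open>v\<close> are arbitrary.\<close>

definition obtained_by_adding_vertex :: "nat \<Rightarrow> real mat \<Rightarrow> nat \<Rightarrow> real mat \<Rightarrow> bool" where
  "obtained_by_adding_vertex n M v N \<longleftrightarrow>
     M \<in> tournament_mats n \<and> v < n \<and> mat_delete M v v = N"

definition is_source :: "real mat \<Rightarrow> nat \<Rightarrow> bool" where
  "is_source M v \<longleftrightarrow> v < dim_row M \<and> (\<forall>u<dim_row M. u \<noteq> v \<longrightarrow> (v, u) \<in> arcs M)"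

definition is_sink :: "real mat \<Rightarrow> nat \<Rightarrow> bool" where
  "is_sink M v \<longleftrightarrow> v < dim_row M \<and> (\<forall>u<dim_row M. u \<noteq> v \<longrightarrow> (u, v) \<in> arcs M)"

definition trivial_singular_maximizer :: "nat \<Rightarrow> real mat \<Rightarrow> bool" where
  "trivial_singular_maximizer n M \<longleftrightarrow>
     singular_maximizer n M \<and>
     (\<exists>N v. (regular_tournament (n - 1) N \<or> almost_regular_tournament (n - 1) N) \<and>
        obtained_by_adding_vertex n M v N)"

definition mutually_reachable :: "real mat \<Rightarrow> (nat \<times> nat) set" where
  "mutually_reachable M =
     {(u, v). u < dim_row M \<and> v < dim_row M \<and> (u, v) \<in> (arcs M)\<^sup>* \<and> (v, u) \<in> (arcs M)\<^sup>*}"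

text \<open>Strongly connected components, given by their vertex sets; the order of a component is the
  cardinality of its vertex set.\<close>

definition strong_components :: "real mat \<Rightarrow> nat set set" where
  "strong_components M = {..<dim_row M} // mutually_reachable M"

end

theory Submission
  imports Defs
begin

text \<open>
  Call a tournament on \<open>m\<close> vertices balanced if \<open>\<bar>2 d - (m - 1)\<bar> \<le> 1\<close> for all its scores \<open>d\<close>; this
  is the same as being regular or almost regular, and by \<open>C\<^sub>3 = (m choose 3) - \<Sum> (d choose 2)\<close> the
  balanced tournaments are exactly the maximizers of \<open>C\<^sub>3\<close> among all tournaments of order \<open>m\<close>.

  A vertex forming a strong component of its own lies on no 3-cycle, so deleting it does not
  change \<open>C\<^sub>3\<close>. Adding a source to a balanced tournament of order \<open>n - 1\<close> gives a singular matrix;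
  hence if a singular maximizer of order \<open>n\<close> has such a vertex, deleting it leaves a maximizer of
  order \<open>n - 1\<close>, which is balanced.

  If \<open>M u = 0\<close> with \<open>u \<noteq> 0\<close>, then \<open>M + M\<^sup>T = J - I\<close> gives \<open>(\<Sum> u\<^sub>i)\<^sup>2 = \<Sum> u\<^sub>i\<^sup>2\<close> and
  \<open>\<Sum> d\<^sub>i u\<^sub>i = (n - 1) \<Sum> u\<^sub>i\<close>, whence \<open>\<Sum> (2 d\<^sub>i - (n - 1))\<^sup>2 \<ge> n (n - 1)\<close>. Adding a vertex to a
  balanced tournament changes the deviations of the other vertices by \<open>\<plusminus>1\<close> only, so this variance
  can be reached for \<open>n \<noteq> 3\<close> only if the new vertex is a source or a sink.
\<close>

section \<open>Tournaments as relations on finite sets: scores and deviations\<close>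

text \<open>\<open>E\<close> is constrained only inside \<open>V\<close>, so an induced
  subtournament keeps the same relation and only \<open>V\<close> shrinks.\<close>

definition tournament_on :: "'a set \<Rightarrow> ('a \<times> 'a) set \<Rightarrow> bool" where
  "tournament_on V E \<longleftrightarrow> finite V \<and> (\<forall>u\<in>V. (u, u) \<notin> E) \<and>
     (\<forall>u\<in>V. \<forall>v\<in>V. u \<noteq> v \<longrightarrow> ((u, v) \<in> E \<longleftrightarrow> (v, u) \<notin> E))"

definition score :: "'a set \<Rightarrow> ('a \<times> 'a) set \<Rightarrow> 'a \<Rightarrow> nat" where
  "score V E u = card {v \<in> V. (u, v) \<in> E}"

definition cyclic_triples :: "'a set \<Rightarrow> ('a \<times> 'a) set \<Rightarrow> 'a set set" where
  "cyclic_triples V E = {S. S \<subseteq> V \<and> card S = 3 \<and>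
     (\<exists>u v w. S = {u, v, w} \<and> (u, v) \<in> E \<and> (v, w) \<in> E \<and> (w, u) \<in> E)}"

text \<open>Twice the offset of a score from the mean \<open>(m - 1) / 2\<close>, with
  \<open>m = card V\<close>. The doubling keeps it an integer, of the parity of
  \<open>m - 1\<close>.\<close>

definition deviation :: "'a set \<Rightarrow> ('a \<times> 'a) set \<Rightarrow> 'a \<Rightarrow> int" where
  "deviation V E u = 2 * int (score V E u) - (int (card V) - 1)"

definition balanced :: "'a set \<Rightarrow> ('a \<times> 'a) set \<Rightarrow> bool" where
  "balanced V E \<longleftrightarrow> (\<forall>u\<in>V. \<bar>deviation V E u\<bar> \<le> 1)"

lemma tournament_on_subset: "tournament_on V E \<Longrightarrow> W \<subseteq> V \<Longrightarrow> tournament_on W E"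
  unfolding tournament_on_def using finite_subset by blast

lemma tournament_onD:
  assumes "tournament_on V E"
  shows "finite V" and "u \<in> V \<Longrightarrow> (u, u) \<notin> E"
    and "u \<in> V \<Longrightarrow> v \<in> V \<Longrightarrow> u \<noteq> v \<Longrightarrow> (u, v) \<in> E \<longleftrightarrow> (v, u) \<notin> E"
  using assms unfolding tournament_on_def by blast+

lemma sum_score:
  assumes "tournament_on V E"
  shows "2 * (\<Sum>u\<in>V. int (score V E u)) = int (card V) * (int (card V) - 1)"
proof -
  have fin: "finite V" using assms by (simp add: tournament_on_def)
  let ?i = "\<lambda>u v. if (u, v) \<in> E then 1 else 0 :: int"
  have s: "int (score V E u) = (\<Sum>v\<in>V. ?i u v)" for u
    using fin by (simp add: score_def sum.If_cases Int_def)
  have "2 * (\<Sum>u\<in>V. \<Sum>v\<in>V. ?i u v) = (\<Sum>u\<in>V. \<Sum>v\<in>V. ?i u v) + (\<Sum>u\<in>V. \<Sum>v\<in>V. ?i v u)"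
    using sum.swap[of ?i V V] by simp
  also have "\<dots> = (\<Sum>u\<in>V. \<Sum>v\<in>V. 1 - (if u = v then 1 else 0))"
    unfolding sum.distrib[symmetric]
  proof (intro sum.cong refl)
    fix u v assume "u \<in> V" "v \<in> V"
    then show "?i u v + ?i v u = 1 - (if u = v then 1 else 0)"
      using tournament_onD(2)[OF assms, of u] tournament_onD(3)[OF assms, of u v]
      by (cases "u = v"; cases "(u, v) \<in> E") simp_all
  qed
  also have "\<dots> = int (card V) * (int (card V) - 1)"
    using fin by (simp add: sum_subtractf)
  finally show ?thesis by (simp add: s)
qed

lemma sum_deviation:
  assumes "tournament_on V E"
  shows "(\<Sum>u\<in>V. deviation V E u) = 0"
  using sum_score[OF assms] by (simp add: deviation_def sum_subtractf sum_distrib_left)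

section \<open>Counting cyclic triples by scores\<close>

text \<open>A triple that is not cyclic has exactly one vertex beating the other two.
  \<open>T\<close> collects these transitive triples, each indexed by that vertex and a pair of its
  out-neighbours, which accounts for the binomials.\<close>

lemma card_cyclic_triples:
  assumes "tournament_on V E"
  shows "card (cyclic_triples V E) + (\<Sum>u\<in>V. score V E u choose 2) = card V choose 3"
proof -
  note fin = tournament_onD(1)[OF assms] and irr = tournament_onD(2)[OF assms]
    and tot = tournament_onD(3)[OF assms]
  define P where "P u = {Q. Q \<subseteq> {v \<in> V. (u, v) \<in> E} \<and> card Q = 2}" for u
  define T where "T = (\<lambda>(u, Q). insert u Q) ` (SIGMA u:V. P u)"
  have finP: "finite (P u)" for u
    unfolding P_def by (rule finite_subset[of _ "Pow V"]) (use fin in auto)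
  have cP: "card (P u) = score V E u choose 2" for u
    unfolding P_def score_def using fin by (intro n_subsets) auto
  have PE: "\<exists>a b. Q = {a, b} \<and> a \<noteq> b \<and> a \<in> V \<and> b \<in> V \<and> (u, a) \<in> E \<and> (u, b) \<in> E \<and> u \<noteq> a \<and> u \<noteq> b"
    if "u \<in> V" "Q \<in> P u" for u Q
  proof -
    have "card Q = 2" using that by (simp add: P_def)
    then obtain a b where "Q = {a, b}" "a \<noteq> b" unfolding card_2_iff by blast
    then show ?thesis using that irr[of u] by (intro exI[of _ a] exI[of _ b]) (auto simp: P_def)
  qed
  have inj: "inj_on (\<lambda>(u, Q). insert u Q) (SIGMA u:V. P u)"
  proof (rule inj_onI, clarify)
    fix u Q u' Q' assume h: "u \<in> V" "Q \<in> P u" "u' \<in> V" "Q' \<in> P u'" "insert u Q = insert u' Q'"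
    have "u = u'"
    proof (rule ccontr)
      assume "u \<noteq> u'"
      then have "u \<in> Q'" "u' \<in> Q" using h by auto
      then have "(u', u) \<in> E" "(u, u') \<in> E" using h by (auto simp: P_def)
      then show False using tot[of u u'] h \<open>u \<noteq> u'\<close> by blast
    qed
    moreover have "u \<notin> Q" "u' \<notin> Q'" using h irr by (auto simp: P_def)
    ultimately show "u = u' \<and> Q = Q'" using h(5) by (auto simp: insert_ident)
  qed
  have cT: "card T = (\<Sum>u\<in>V. score V E u choose 2)"
    unfolding T_def card_image[OF inj] using fin finP by (simp add: cP)
  have disj: "cyclic_triples V E \<inter> T = {}"
  proof (rule ccontr)
    assume "cyclic_triples V E \<inter> T \<noteq> {}"
    then obtain S where S: "S \<in> cyclic_triples V E" "S \<in> T" by blast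
    from S(2) obtain u Q where h: "S = insert u Q" "u \<in> V" "Q \<in> P u" by (auto simp: T_def)
    from S(1) obtain x y z where xyz: "S = {x, y, z}" "S \<subseteq> V" "(x, y) \<in> E" "(y, z) \<in> E" "(z, x) \<in> E"
      unfolding cyclic_triples_def by blast
    from h(1) xyz(1,2) have h': "insert u Q = {x, y, z}" "{x, y, z} \<subseteq> V" by simp_all
    have "\<And>w. w \<in> {x, y, z} \<Longrightarrow> w = u \<or> (u, w) \<in> E"
      using h(3) h'(1) unfolding P_def by blast
    then have "\<And>w. w \<in> {x, y, z} \<Longrightarrow> (w, u) \<notin> E"
      using tot[OF _ h(2)] irr[OF h(2)] h'(2) by (metis subsetD)
    moreover have "u \<in> {x, y, z}" using h'(1) by auto
    ultimately show False using xyz(3-5) by blast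
  qed
  have un: "cyclic_triples V E \<union> T = {S. S \<subseteq> V \<and> card S = 3}"
  proof (intro equalityI subsetI)
    fix S assume "S \<in> cyclic_triples V E \<union> T"
    then show "S \<in> {S. S \<subseteq> V \<and> card S = 3}"
    proof
      assume "S \<in> T"
      then obtain u Q where "u \<in> V" "Q \<in> P u" "S = insert u Q" by (auto simp: T_def)
      with PE[of u Q] show ?thesis by auto
    qed (simp add: cyclic_triples_def)
  next
    fix S assume "S \<in> {S. S \<subseteq> V \<and> card S = 3}"
    then obtain x y z where S: "S = {x, y, z}" "x \<noteq> y" "y \<noteq> z" "x \<noteq> z" and V: "x \<in> V" "y \<in> V" "z \<in> V"
      by (auto simp: card_3_iff)
    have TI: "S \<in> T" if "S = {u, v, w}" "(u, v) \<in> E" "(u, w) \<in> E" "v \<noteq> w" "u \<in> V" "v \<in> V" "w \<in> V" for u v w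
      unfolding T_def using that by (intro image_eqI[of _ _ "(u, {v, w})"]) (auto simp: P_def)
    have CI: "S \<in> cyclic_triples V E" if "S = {u, v, w}" "(u, v) \<in> E" "(v, w) \<in> E" "(w, u) \<in> E" for u v w
    proof -
      have "card S = 3" "S \<subseteq> V" using S V by auto
      then show ?thesis unfolding cyclic_triples_def using that by blast
    qed
    have perm: "S = {x, y, z}" "S = {x, z, y}" "S = {y, x, z}" "S = {z, x, y}" using S by auto
    \<comment> \<open>Of the eight orientations two are cyclic; in each of the other six, one of
      \<open>x\<close>, \<open>y\<close>, \<open>z\<close> beats both others.\<close>
    show "S \<in> cyclic_triples V E \<union> T"
      using TI[of x y z] TI[of y x z] TI[of z x y] CI[of x y z] CI[of x z y] perm S V
        tot[of x y] tot[of x z] tot[of y z] by blast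
  qed
  have "finite (cyclic_triples V E \<union> T)" unfolding un using fin by simp
  then have "card (cyclic_triples V E) + card T = card {S. S \<subseteq> V \<and> card S = 3}"
    using disj by (simp flip: un add: card_Un_disjoint)
  then show ?thesis using n_subsets[OF fin, of 3] cT by simp
qed

text \<open>The squared deviations and the binomials of the triple count are both quadratic in the
  scores, whose sum is fixed. For a given order, more cyclic triples thus mean a smaller sum of
  squares.\<close>

lemma sum_deviation_squared:
  assumes "tournament_on V E"
  shows "(\<Sum>u\<in>V. (deviation V E u)\<^sup>2) + 8 * int (card (cyclic_triples V E)) =
    8 * int (card V choose 3) + int (card V) * (int (card V) - 1) * (3 - int (card V))"
proof -
  define m where "m = int (card V)"
  have ch: "2 * int (s choose 2) = int s * (int s - 1)" for s :: nat
  proof -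
    have "even (s * (s - 1))" by (cases s) auto
    then have "2 * (s choose 2) = s * (s - 1)" by (simp add: choose_two)
    then have "int (2 * (s choose 2)) = int (s * (s - 1))" by simp
    then show ?thesis by (cases s) (simp_all add: algebra_simps)
  qed
  have "(deviation V E u)\<^sup>2 =
      8 * int (score V E u choose 2) + 4 * (2 - m) * int (score V E u) + (m - 1)\<^sup>2" for u
    using ch[of "score V E u"] unfolding deviation_def m_def[symmetric]
    by (simp add: power2_eq_square algebra_simps)
  then have "(\<Sum>u\<in>V. (deviation V E u)\<^sup>2) = 8 * (\<Sum>u\<in>V. int (score V E u choose 2))
      + 4 * (2 - m) * (\<Sum>u\<in>V. int (score V E u)) + m * (m - 1)\<^sup>2"
    by (simp add: sum.distrib sum_distrib_left m_def)
  moreover have "4 * (2 - m) * (\<Sum>u\<in>V. int (score V E u)) = 2 * (2 - m) * (m * (m - 1))"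
    unfolding sum_score[OF assms, folded m_def, symmetric] by simp
  moreover have "int (card (cyclic_triples V E)) + (\<Sum>u\<in>V. int (score V E u choose 2)) = int (card V choose 3)"
    using card_cyclic_triples[OF assms] by (metis of_nat_add of_nat_sum)
  ultimately show ?thesis
    unfolding m_def[symmetric] by (simp add: algebra_simps power2_eq_square)
qed

text \<open>\<open>W\<close> attains the parity minimum at every vertex and \<open>V\<close> has no
  larger sum of squares, so \<open>V\<close> attains that minimum at every vertex as well.\<close>

lemma balanced_if_cyclic_triples_ge:
  assumes V: "tournament_on V E" and W: "tournament_on W F" "balanced W F"
    and card: "card W = card V"
    and le: "card (cyclic_triples W F) \<le> card (cyclic_triples V E)"
  shows "balanced V E"
proof -
  \<comment> \<open>The least square of an integer with the parity of
    \<open>card V - 1\<close>.\<close>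
  define c :: int where "c = (if even (card V) then 1 else 0)"
  have fin: "finite V" using V by (simp add: tournament_on_def)
  have ge: "c \<le> (deviation V E u)\<^sup>2" for u
  proof (cases "even (card V)")
    case True
    then have "deviation V E u \<noteq> 0" by (auto simp: deviation_def) presburger
    then have "0 < (deviation V E u)\<^sup>2" by simp
    then have "1 \<le> (deviation V E u)\<^sup>2" by linarith
    then show ?thesis using True by (simp only: c_def if_True)
  qed (simp add: c_def)
  have "(deviation W F u)\<^sup>2 = c" if "u \<in> W" for u
  proof -
    have b: "\<bar>deviation W F u\<bar> \<le> 1" using W that by (auto simp: balanced_def)
    have "even (deviation W F u) \<longleftrightarrow> odd (card V)" by (simp add: deviation_def card)
    moreover have "deviation W F u = 0 \<or> deviation W F u = 1 \<or> deviation W F u = -1" using b by linarith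
    ultimately show ?thesis by (auto simp: c_def)
  qed
  then have "(\<Sum>u\<in>W. (deviation W F u)\<^sup>2) = (\<Sum>u\<in>V. c)" using card by simp
  moreover have "(\<Sum>u\<in>V. (deviation V E u)\<^sup>2) \<le> (\<Sum>u\<in>W. (deviation W F u)\<^sup>2)"
    using sum_deviation_squared[OF V] sum_deviation_squared[OF W(1)] le card by simp
  ultimately have "(\<Sum>u\<in>V. (deviation V E u)\<^sup>2 - c) \<le> 0" by (simp add: sum_subtractf)
  then have "(\<Sum>u\<in>V. (deviation V E u)\<^sup>2 - c) = 0"
    using ge by (intro antisym sum_nonneg) auto
  then have "\<forall>u\<in>V. (deviation V E u)\<^sup>2 - c = 0"
    using ge fin by (subst (asm) sum_nonneg_eq_0_iff) auto
  then have "\<forall>u\<in>V. (deviation V E u)\<^sup>2 \<le> 1" by (auto simp: c_def)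
  then show ?thesis by (simp add: balanced_def abs_square_le_1)
qed

section \<open>Adding a vertex to a balanced tournament\<close>

lemma score_zero_or_full_if_balanced_minus:
  assumes T: "tournament_on V E" and v: "v \<in> V"
    and bal: "balanced (V - {v}) E" and "card V \<noteq> 3"
    and bound: "int (card V) * (int (card V) - 1) \<le> (\<Sum>u\<in>V. (deviation V E u)\<^sup>2)"
  shows "score V E v = 0 \<or> score V E v = card V - 1"
proof -
  note fin = tournament_onD(1)[OF T]
  define W where "W = V - {v}"
  \<comment> \<open>Outdegree and indegree of \<open>v\<close>; the aim is that one of them
    vanishes.\<close>
  define k l where "k = int (score V E v)" and "l = int (card V) - 1 - k"
  define b where "b = deviation W E"
  define x :: "'a \<Rightarrow> int" where "x u = (if (v, u) \<in> E then 1 else 0)" for u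
  have W: "finite W" "tournament_on W E" using fin tournament_on_subset[OF T] by (auto simp: W_def)
  have cW: "int (card W) = k + l" "int (card V) = k + l + 1"
    using card.remove[OF fin v] by (auto simp: W_def l_def)
  have outW: "{u \<in> V. (v, u) \<in> E} = {u \<in> W. (v, u) \<in> E}"
    using tournament_onD(2)[OF T v] by (auto simp: W_def)
  have k: "k = (\<Sum>u\<in>W. x u)"
    unfolding k_def score_def outW x_def using W by (simp add: sum.If_cases Int_def)
  have "score V E v \<le> card W" unfolding score_def outW using W by (intro card_mono) auto
  then have nn: "0 \<le> k" "0 \<le> l" using cW by (auto simp: k_def)
  have b0: "(\<Sum>u\<in>W. b u) = 0" unfolding b_def using W by (intro sum_deviation)
  have dev: "deviation V E u = b u + 1 - 2 * x u" if "u \<in> W" for u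
  proof -
    have "u \<noteq> v" "u \<in> V" using that by (auto simp: W_def)
    then have e: "(u, v) \<in> E \<longleftrightarrow> (v, u) \<notin> E" using tournament_onD(3)[OF T _ v] by blast
    have "{w \<in> V. (u, w) \<in> E} = {w \<in> W. (u, w) \<in> E} \<union> (if (u, v) \<in> E then {v} else {})"
      using v by (auto simp: W_def)
    then have "int (score V E u) = int (score W E u) + 1 - x u"
      using W e by (auto simp: score_def x_def card_insert_if W_def)
    then show ?thesis by (simp add: b_def deviation_def cW)
  qed
  have b1: "\<bar>b u\<bar> \<le> 1" if "u \<in> W" for u
    using bal that by (auto simp: balanced_def b_def W_def)
  have sq: "(b u)\<^sup>2 \<le> 1" if "u \<in> W" for u using b1[OF that] by (simp add: abs_square_le_1)
  have "(\<Sum>u\<in>V. (deviation V E u)\<^sup>2) = (k - l)\<^sup>2 + (\<Sum>u\<in>W. (deviation V E u)\<^sup>2)"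
    unfolding W_def sum.remove[OF fin v]
    by (simp add: deviation_def cW algebra_simps flip: k_def)
  \<comment> \<open>The square is at most \<open>2 + 2 * b u\<close> if \<open>x u = 0\<close> and
    at most \<open>2 - 2 * b u\<close> if \<open>x u = 1\<close>. Both this bound and the next
    dominate the two cases by one expression in which \<open>b\<close> has the same coefficient on
    all of \<open>W\<close>, so that the zero sum of \<open>b\<close> removes it.\<close>
  moreover have "(\<Sum>u\<in>W. (deviation V E u)\<^sup>2) \<le> (\<Sum>u\<in>W. 2 + 2 * b u + 4 * x u)"
  proof (rule sum_mono)
    fix u assume u: "u \<in> W"
    show "(deviation V E u)\<^sup>2 \<le> 2 + 2 * b u + 4 * x u"
      using b1[OF u] sq[OF u] by (auto simp: dev[OF u] x_def power2_eq_square algebra_simps)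
  qed
  moreover have "(\<Sum>u\<in>W. (deviation V E u)\<^sup>2) \<le> (\<Sum>u\<in>W. 6 - 2 * b u - 4 * x u)"
  proof (rule sum_mono)
    fix u assume u: "u \<in> W"
    show "(deviation V E u)\<^sup>2 \<le> 6 - 2 * b u - 4 * x u"
      using b1[OF u] sq[OF u] by (auto simp: dev[OF u] x_def power2_eq_square algebra_simps)
  qed
  moreover have "(\<Sum>u\<in>W. 2 + 2 * b u + 4 * x u) = 2 * (k + l) + 4 * k"
    by (simp add: sum.distrib b0 cW flip: sum_distrib_left k)
  moreover have "(\<Sum>u\<in>W. 6 - 2 * b u - 4 * x u) = 6 * (k + l) - 4 * k"
    by (simp add: sum_subtractf b0 cW flip: sum_distrib_left k)
  ultimately have le: "4 * (k * l) \<le> 5 * k + l" "4 * (k * l) \<le> k + 5 * l"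
    using bound unfolding cW by (auto simp: power2_eq_square algebra_simps)
  \<comment> \<open>\<open>k = l = 1\<close> is the only solution of \<open>le\<close> with both
    positive, and it means order three.\<close>
  have ne: "k + l \<noteq> 2" using \<open>card V \<noteq> 3\<close> cW by linarith
  have "k = 0 \<or> l = 0"
  proof (rule ccontr)
    assume "\<not> ?thesis"
    then consider "k = 1" "1 \<le> l" | "l = 1" "1 \<le> k" | "2 \<le> k" "2 \<le> l" using nn by linarith
    then show False
    proof cases
      case 3
      have "2 * l \<le> k * l" "k * 2 \<le> k * l" using 3 by (auto intro: mult_right_mono mult_left_mono)
      then show False using le 3 by linarith
    qed (use le ne in auto)
  qed
  then show ?thesis using cW by (auto simp: k_def)
qed

section \<open>Tournament matrices and their arcs\<close>

lemma tournament_mats_entries: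
  assumes "M \<in> tournament_mats n" "i < n" "j < n"
  shows "M $$ (i, j) \<in> {0, 1}" and "M $$ (i, j) + M $$ (j, i) = (if i = j then 0 else 1)"
proof -
  have M: "M \<in> carrier_mat n n" and s: "M + transpose_mat M = all_ones_mat n - 1\<^sub>m n"
    using assms by (auto simp: tournament_mats_def)
  show "M $$ (i, j) \<in> {0, 1}" using assms unfolding tournament_mats_def by blast
  have "M $$ (i, j) + M $$ (j, i) = (M + transpose_mat M) $$ (i, j)" using M assms by simp
  also have "\<dots> = (if i = j then 0 else 1)" unfolding s using assms by (simp add: all_ones_mat_def)
  finally show "M $$ (i, j) + M $$ (j, i) = (if i = j then 0 else 1)" .
qed

lemma tournament_matsI:
  assumes "M \<in> carrier_mat n n" "\<And>i j. i < n \<Longrightarrow> j < n \<Longrightarrow> M $$ (i, j) \<in> {0, 1}"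
    and "\<And>i j. i < n \<Longrightarrow> j < n \<Longrightarrow> M $$ (i, j) + M $$ (j, i) = (if i = j then 0 else 1)"
  shows "M \<in> tournament_mats n"
proof -
  have "M + transpose_mat M = all_ones_mat n - 1\<^sub>m n"
    using assms(1,3) by (intro eq_matI) (auto simp: all_ones_mat_def)
  then show ?thesis using assms unfolding tournament_mats_def by blast
qed

lemma dim_row_tournament_mats: "M \<in> tournament_mats n \<Longrightarrow> dim_row M = n"
  by (auto simp: tournament_mats_def)

lemma arcs_tournament_mats:
  assumes "M \<in> tournament_mats n"
  shows "(i, j) \<in> arcs M \<longleftrightarrow> i < n \<and> j < n \<and> M $$ (i, j) = 1"
  using assms by (auto simp: arcs_def tournament_mats_def)

lemma tournament_on_arcs:
  assumes "M \<in> tournament_mats n"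
  shows "tournament_on {..<n} (arcs M)"
proof -
  have "(i, j) \<in> arcs M \<longleftrightarrow> (j, i) \<notin> arcs M" if "i < n" "j < n" "i \<noteq> j" for i j
    using tournament_mats_entries[OF assms that(1,2)] tournament_mats_entries(1)[OF assms that(2,1)] that
    by (auto simp: arcs_tournament_mats[OF assms])
  moreover have "(i, i) \<notin> arcs M" if "i < n" for i
    using tournament_mats_entries[OF assms that that] by (auto simp: arcs_tournament_mats[OF assms])
  ultimately show ?thesis unfolding tournament_on_def by blast
qed

lemma outdegree_eq_score:
  assumes "M \<in> tournament_mats n"
  shows "outdegree M u = score {..<n} (arcs M) u"
  unfolding outdegree_def score_def
  by (rule arg_cong[of _ _ card]) (auto simp: arcs_tournament_mats[OF assms])

section \<open>Score variance of a singular tournament\<close>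

text \<open>Cauchy--Schwarz: the kernel vector \<open>u\<close> has squared norm
  \<open>s\<^sup>2\<close> and inner product \<open>n * s\<close> with \<open>e + 1\<close>, so
  \<open>e + 1\<close> has squared norm at least \<open>n\<^sup>2\<close>. As \<open>e\<close> sums
  to zero, that squared norm exceeds the sum of the \<open>(e i)\<^sup>2\<close> by exactly
  \<open>n\<close>.\<close>

lemma singular_score_variance:
  assumes "M \<in> singular_tournament_mats n"
  shows "int n * (int n - 1) \<le> (\<Sum>i<n. (deviation {..<n} (arcs M) i)\<^sup>2)"
proof -
  have M: "M \<in> tournament_mats n" "M \<in> carrier_mat n n" "det M = 0"
    using assms by (auto simp: singular_tournament_mats_def tournament_mats_def)
  define d where "d i = (\<Sum>j<n. M $$ (i, j))" for i
  define e where "e i = real_of_int (deviation {..<n} (arcs M) i)" for i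
  obtain w where w: "w \<in> carrier_vec n" "w \<noteq> 0\<^sub>v n" "M *\<^sub>v w = 0\<^sub>v n"
    using M det_0_iff_vec_prod_zero by blast
  define u where "u i = w $ i" for i
  define s where "s = (\<Sum>i<n. u i)"
  have Mu: "(\<Sum>j<n. M $$ (i, j) * u j) = 0" if "i < n" for i
  proof -
    have "(M *\<^sub>v w) $ i = 0" using w(3) that by simp
    then show ?thesis using that M(2) w(1)
      by (simp add: scalar_prod_def u_def lessThan_atLeast0)
  qed
  \<comment> \<open>On the kernel of \<open>M\<close> the transpose acts as
    \<open>J - I\<close>.\<close>
  have uM: "(\<Sum>i<n. M $$ (i, j) * u i) = s - u j" if j: "j < n" for j
  proof -
    have "(\<Sum>i<n. M $$ (i, j) * u i) = (\<Sum>i<n. u i - (if i = j then u i else 0) - M $$ (j, i) * u i)"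
    proof (intro sum.cong refl)
      fix i assume "i \<in> {..<n}"
      then have "M $$ (i, j) = (if i = j then 0 else 1) - M $$ (j, i)"
        unfolding eq_diff_eq using j by (intro tournament_mats_entries(2)[OF M(1)]) auto
      then show "M $$ (i, j) * u i = u i - (if i = j then u i else 0) - M $$ (j, i) * u i"
        by (simp only: left_diff_distrib) simp
    qed
    then show ?thesis using Mu[OF j] j by (simp add: sum_subtractf s_def)
  qed
  \<comment> \<open>The quadratic forms of \<open>M\<close> and of its transpose agree, and that of
    \<open>M\<close> vanishes at \<open>u\<close>.\<close>
  have "(\<Sum>j<n. u j * (s - u j)) = (\<Sum>j<n. u j * (\<Sum>i<n. M $$ (i, j) * u i))"
    by (intro sum.cong) (simp_all add: uM)
  also have "\<dots> = (\<Sum>i<n. u i * (\<Sum>j<n. M $$ (i, j) * u j))"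
    unfolding sum_distrib_left by (subst sum.swap) (simp add: mult_ac)
  also have "\<dots> = 0" by (simp add: Mu)
  finally have norm: "(\<Sum>j<n. (u j)\<^sup>2) = s\<^sup>2"
    by (simp add: algebra_simps sum_subtractf power2_eq_square s_def flip: sum_distrib_right)
  have "(\<Sum>i<n. d i * u i) = (\<Sum>j<n. \<Sum>i<n. M $$ (i, j) * u i)"
    unfolding d_def sum_distrib_right by (rule sum.swap)
  also have "\<dots> = real n * s - s" by (simp add: uM sum_subtractf s_def)
  finally have du: "(\<Sum>i<n. d i * u i) = real n * s - s" .
  have "\<exists>i<n. u i \<noteq> 0" using w by (auto simp: u_def vec_eq_iff)
  then have "0 < (\<Sum>j<n. (u j)\<^sup>2)" by (auto intro!: sum_pos2)
  then have s: "s \<noteq> 0" by (auto simp: norm)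
  have d: "d i = real (score {..<n} (arcs M) i)" if "i < n" for i
  proof -
    have "d i = (\<Sum>j<n. if (i, j) \<in> arcs M then 1 else 0)"
      unfolding d_def using tournament_mats_entries(1)[OF M(1) that] that
      by (intro sum.cong) (auto simp: arcs_tournament_mats[OF M(1)])
    then show ?thesis by (simp add: score_def sum.If_cases Int_def)
  qed
  have e: "e i = 2 * d i - (real n - 1)" if "i < n" for i
    by (simp add: e_def deviation_def d[OF that])
  have e0: "(\<Sum>i<n. e i) = 0"
    using sum_deviation[OF tournament_on_arcs[OF M(1)]] unfolding e_def
    by (metis of_int_0 of_int_sum)
  have "(\<Sum>i<n. e i * u i) = (\<Sum>i<n. 2 * (d i * u i) - (real n - 1) * u i)"
    by (intro sum.cong) (simp_all add: e algebra_simps)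
  also have "\<dots> = (real n - 1) * s"
    by (simp add: sum_subtractf du flip: sum_distrib_left s_def) (simp add: algebra_simps)
  finally have eu: "(\<Sum>i<n. e i * u i) = (real n - 1) * s" .
  define t where "t = real n / s"
  have ts: "t * s = real n" using s by (simp add: t_def)
  \<comment> \<open>The multiple of \<open>u\<close> and the shift are those for which Cauchy--Schwarz would be sharp.\<close>
  have "0 \<le> (\<Sum>i<n. (e i - t * u i + 1)\<^sup>2)" by (intro sum_nonneg) simp
  also have "\<dots> = (\<Sum>i<n. (e i)\<^sup>2 + t\<^sup>2 * (u i)\<^sup>2 + 1 - 2 * t * (e i * u i) + 2 * e i - 2 * t * u i)"
    by (intro sum.cong) (simp_all add: power2_eq_square algebra_simps)
  also have "\<dots> = (\<Sum>i<n. (e i)\<^sup>2) + (t * s)\<^sup>2 + real n - 2 * (real n - 1) * (t * s) - 2 * (t * s)"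
    by (simp add: sum.distrib sum_subtractf norm eu e0 power_mult_distrib flip: sum_distrib_left s_def)
  also have "\<dots> = (\<Sum>i<n. (e i)\<^sup>2) - real n * (real n - 1)"
    unfolding ts by (simp add: power2_eq_square algebra_simps)
  finally have "real_of_int (int n * (int n - 1)) \<le> real_of_int (\<Sum>i<n. (deviation {..<n} (arcs M) i)\<^sup>2)"
    by (simp add: e_def)
  then show ?thesis by (simp only: of_int_le_iff)
qed

section \<open>Balance, regularity and vertex deletion\<close>

text \<open>Scores at most one apart have deviations at most two apart. A deviation of at least 2
  would then make all others nonnegative, against their zero sum; -2 is symmetric. Conversely,
  deviations between -1 and 1 keep the scores within one of each other.\<close>

lemma regular_or_almost_regular_iff_balanced:
  assumes N: "N \<in> tournament_mats m"
  shows "regular_tournament m N \<or> almost_regular_tournament m N \<longleftrightarrow> balanced {..<m} (arcs N)"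
    (is "?L \<longleftrightarrow> ?R")
proof -
  define \<delta> where "\<delta> = deviation {..<m} (arcs N)"
  have \<delta>: "\<delta> u = 2 * int (outdegree N u) - (int m - 1)" for u
    by (simp add: \<delta>_def deviation_def outdegree_eq_score[OF N])
  have sum0: "(\<Sum>u<m. \<delta> u) = 0"
    unfolding \<delta>_def using tournament_on_arcs[OF N] by (rule sum_deviation)
  let ?D = "(\<lambda>(u, v). int (outdegree N u) - int (outdegree N v)) ` ({..<m} \<times> {..<m})"
  show ?thesis
  proof
    assume ?L
    then have close: "\<delta> u \<le> \<delta> v + 2" if "u < m" "v < m" for u v
    proof
      assume "regular_tournament m N"
      then have "outdegree N u = outdegree N v" using that unfolding regular_tournament_def by blast
      then show ?thesis by (simp add: \<delta>)
    next
      assume "almost_regular_tournament m N"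
      then have "Max ?D = 1" by (simp add: almost_regular_tournament_def)
      moreover have "int (outdegree N u) - int (outdegree N v) \<le> Max ?D"
        using that by (intro Max_ge) auto
      ultimately show ?thesis by (simp add: \<delta>)
    qed
    have "\<bar>\<delta> u\<bar> \<le> 1" if u: "u < m" for u
    proof (rule ccontr)
      assume "\<not> \<bar>\<delta> u\<bar> \<le> 1"
      then consider "2 \<le> \<delta> u" | "\<delta> u \<le> - 2" by linarith
      then show False
      proof cases
        case 1
        then have "0 < (\<Sum>v<m. \<delta> v)" using close[OF u] u by (intro sum_pos2[of _ u]) force+
        then show False using sum0 by simp
      next
        case 2
        have "- \<delta> v \<ge> 0" if "v < m" for v using close[OF that u] 2 by simp
        then have "0 < (\<Sum>v<m. - \<delta> v)" using 2 u by (intro sum_pos2[of _ u]) auto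
        then show False using sum0 by (simp add: sum_negf)
      qed
    qed
    then show ?R by (simp add: balanced_def \<delta>_def)
  next
    assume R: ?R
    have diff: "int (outdegree N u) - int (outdegree N v) \<le> 1" if "u < m" "v < m" for u v
    proof -
      have "\<bar>\<delta> u\<bar> \<le> 1" "\<bar>\<delta> v\<bar> \<le> 1" using R that by (auto simp: balanced_def \<delta>_def)
      then show ?thesis by (simp add: \<delta>)
    qed
    show ?L
    proof (cases "\<exists>u<m. \<exists>v<m. outdegree N u \<noteq> outdegree N v")
      case True
      then obtain u v where uv: "u < m" "v < m" "outdegree N u < outdegree N v"
        by (metis nat_neq_iff)
      then have "1 \<in> ?D" using diff[OF uv(2,1)] by (intro image_eqI[of _ _ "(v, u)"]) auto
      then have "Max ?D = 1" using diff by (intro Max_eqI) auto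
      then show ?thesis using N uv by (simp add: almost_regular_tournament_def)
    next
      case False
      then show ?thesis using N unfolding regular_tournament_def by blast
    qed
  qed
qed

lemma bij_betw_insert_index:
  assumes "v < n"
  shows "bij_betw (insert_index v) {..<n - 1} ({..<n} - {v})"
  using insert_index_image[of v "n - 1"] insert_index_inj_on[of v] assms
  by (simp add: bij_betw_def lessThan_atLeast0)

lemma mat_delete_tournament:
  assumes M: "M \<in> tournament_mats n" and v: "v < n"
  shows "mat_delete M v v \<in> tournament_mats (n - 1)"
    and "i < n - 1 \<Longrightarrow> j < n - 1 \<Longrightarrow>
      (i, j) \<in> arcs (mat_delete M v v) \<longleftrightarrow> (insert_index v i, insert_index v j) \<in> arcs M"
proof -
  \<comment> \<open>\<open>v < n\<close> makes \<open>n\<close> positive;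
    \<open>mat_delete_index\<close> wants the order as a successor.\<close>
  have c: "M \<in> carrier_mat (Suc (n - 1)) (Suc (n - 1))"
    using M v by (simp add: tournament_mats_def)
  have entry: "mat_delete M v v $$ (i, j) = M $$ (insert_index v i, insert_index v j)"
    if "i < n - 1" "j < n - 1" for i j
    using mat_delete_index[OF c, of v v i j] v that by simp
  have lt: "insert_index v i < n" if "i < n - 1" for i
    using that by (auto simp: insert_index_def)
  have inj: "insert_index v i = insert_index v j \<longleftrightarrow> i = j" for i j
    using insert_index_inj_on[of v UNIV] by (auto dest: injD)
  show N: "mat_delete M v v \<in> tournament_mats (n - 1)"
  proof (rule tournament_matsI)
    show "mat_delete M v v \<in> carrier_mat (n - 1) (n - 1)" using mat_delete_carrier[OF c] by simp
    fix i j assume ij: "i < n - 1" "j < n - 1"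
    show "mat_delete M v v $$ (i, j) \<in> {0, 1}"
      using tournament_mats_entries(1)[OF M lt lt] ij by (simp only: entry)
    show "mat_delete M v v $$ (i, j) + mat_delete M v v $$ (j, i) = (if i = j then 0 else 1)"
      using tournament_mats_entries(2)[OF M lt lt] ij by (simp only: entry inj)
  qed
  show "(i, j) \<in> arcs (mat_delete M v v) \<longleftrightarrow> (insert_index v i, insert_index v j) \<in> arcs M"
    if "i < n - 1" "j < n - 1"
    unfolding arcs_tournament_mats[OF N] arcs_tournament_mats[OF M]
    using that lt by (simp add: entry)
qed

lemma balanced_mat_delete:
  assumes M: "M \<in> tournament_mats n" and v: "v < n"
  shows "balanced {..<n - 1} (arcs (mat_delete M v v)) \<longleftrightarrow> balanced ({..<n} - {v}) (arcs M)"
proof -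
  let ?f = "insert_index v"
  note bij = bij_betw_insert_index[OF v]
  have im: "?f ` {..<n - 1} = {..<n} - {v}" using bij by (simp add: bij_betw_def)
  have card: "card ({..<n} - {v}) = card {..<n - 1}" using bij_betw_same_card[OF bij] by simp
  have "score ({..<n} - {v}) (arcs M) (?f i) = score {..<n - 1} (arcs (mat_delete M v v)) i"
    if "i < n - 1" for i
  proof -
    have "{w \<in> {..<n} - {v}. (?f i, w) \<in> arcs M} =
        ?f ` {j \<in> {..<n - 1}. (i, j) \<in> arcs (mat_delete M v v)}"
      unfolding im[symmetric] using mat_delete_tournament(2)[OF M v that] by auto
    then show ?thesis by (simp add: score_def card_image insert_index_inj_on)
  qed
  then have "deviation ({..<n} - {v}) (arcs M) (?f i) = deviation {..<n - 1} (arcs (mat_delete M v v)) i"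
    if "i < n - 1" for i
    using that by (simp only: deviation_def card)
  then show ?thesis unfolding balanced_def im[symmetric] by auto
qed

text \<open>Since \<open>v\<close> determines \<open>N\<close>, conditions (i) and (ii) become
  statements about \<open>v\<close> alone.\<close>

lemma added_to_regular_or_almost_regular_iff:
  assumes "M \<in> tournament_mats n"
  shows "(regular_tournament (n - 1) N \<or> almost_regular_tournament (n - 1) N) \<and>
      obtained_by_adding_vertex n M v N \<longleftrightarrow>
    v < n \<and> N = mat_delete M v v \<and> balanced ({..<n} - {v}) (arcs M)"
  using regular_or_almost_regular_iff_balanced[OF mat_delete_tournament(1)[OF assms, of v]]
    balanced_mat_delete[OF assms, of v] assms
  unfolding obtained_by_adding_vertex_def by blast

section \<open>Sources and sinks from extreme scores\<close>

lemma is_sink_if_score_zero: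
  assumes M: "M \<in> tournament_mats n" and v: "v < n" and "score {..<n} (arcs M) v = 0"
  shows "is_sink M v"
proof -
  have "(v, u) \<notin> arcs M" if "u < n" for u using assms(3) that by (auto simp: score_def)
  then have "(u, v) \<in> arcs M" if "u < n" "u \<noteq> v" for u
    using tournament_onD(3)[OF tournament_on_arcs[OF M], of u v] that v by blast
  moreover have "dim_row M = n" using M by (rule dim_row_tournament_mats)
  ultimately show ?thesis using v by (simp add: is_sink_def)
qed

lemma is_source_if_score_full:
  assumes M: "M \<in> tournament_mats n" and v: "v < n" and "score {..<n} (arcs M) v = n - 1"
  shows "is_source M v"
proof -
  have "{u \<in> {..<n}. (v, u) \<in> arcs M} \<subseteq> {..<n} - {v}"
    using tournament_onD(2)[OF tournament_on_arcs[OF M]] v by auto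
  then have "{u \<in> {..<n}. (v, u) \<in> arcs M} = {..<n} - {v}"
    using assms(3) v by (intro card_subset_eq) (auto simp: score_def)
  moreover have "dim_row M = n" using M by (rule dim_row_tournament_mats)
  ultimately show ?thesis using v by (auto simp: is_source_def)
qed

text \<open>Serves order three, where deleting any vertex leaves two.\<close>

lemma balanced_card_two:
  assumes "tournament_on V E" "card V = 2"
  shows "balanced V E"
proof -
  have "score V E u \<le> 1" if "u \<in> V" for u
  proof -
    have "score V E u \<le> card (V - {u})" unfolding score_def
      using tournament_onD(1,2)[OF assms(1)] that by (intro card_mono) auto
    then show ?thesis using assms that by (simp add: tournament_onD(1))
  qed
  then show ?thesis using assms by (force simp: balanced_def deviation_def)
qed

text \<open>The step from (i) to (ii). Outside order three the variance bound forces an extreme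
  score on \<open>v\<close> itself.\<close>

lemma singular_trivial_imp_source_or_sink:
  assumes S: "M \<in> singular_tournament_mats n" and v: "v < n"
    and bal: "balanced ({..<n} - {v}) (arcs M)"
  shows "\<exists>w<n. balanced ({..<n} - {w}) (arcs M) \<and> (is_source M w \<or> is_sink M w)"
proof -
  have M: "M \<in> tournament_mats n" using S by (simp add: singular_tournament_mats_def)
  note T = tournament_on_arcs[OF M] and bound = singular_score_variance[OF S]
  show ?thesis
  proof (cases "n = 3")
    case False
    then have "score {..<n} (arcs M) v = 0 \<or> score {..<n} (arcs M) v = n - 1"
      using score_zero_or_full_if_balanced_minus[OF T _ bal] v bound by simp
    then show ?thesis using is_sink_if_score_zero[OF M v] is_source_if_score_full[OF M v] v bal by blast
  next
    case True
    \<comment> \<open>Here \<open>v\<close> may be the middle vertex of the transitive tournament, so another one is needed.\<close>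
    have "\<exists>w<n. deviation {..<n} (arcs M) w \<noteq> 0"
      using bound True by (intro ccontr[of "\<exists>w<n. _ w"]) auto
    then obtain w where w: "w < n" "deviation {..<n} (arcs M) w \<noteq> 0" by blast
    have "score {..<n} (arcs M) w \<le> card ({..<n} - {w})" unfolding score_def
      using tournament_onD(2)[OF T] w by (intro card_mono) auto
    \<comment> \<open>Among three vertices a score is 0, 1 or 2, and a score of 1 has deviation
      zero.\<close>
    then have "score {..<n} (arcs M) w = 0 \<or> score {..<n} (arcs M) w = n - 1"
      using w True by (auto simp: deviation_def)
    moreover have "balanced ({..<n} - {w}) (arcs M)"
      using tournament_on_subset[OF T] True w by (intro balanced_card_two) auto
    ultimately show ?thesis using is_sink_if_score_zero[OF M] is_source_if_score_full[OF M] w by blast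
  qed
qed

section \<open>A balanced tournament of every order and a singular competitor\<close>

text \<open>On \<open>{..<m}\<close> with \<open>m\<close> odd this is the rotational tournament
  modulo \<open>m\<close> with connection set 1, 3, ..., \<open>m - 2\<close>. One relation serves
  all orders, which permits induction on \<open>m\<close>.\<close>

definition parity_arcs :: "(nat \<times> nat) set" where
  "parity_arcs = {(i, j). i < j \<and> odd (i + j) \<or> j < i \<and> even (i + j)}"

lemma tournament_on_parity_arcs: "finite V \<Longrightarrow> tournament_on V parity_arcs"
  by (auto simp: tournament_on_def parity_arcs_def)

text \<open>The branch \<open>m \<le> i\<close> covers a vertex outside the segment; the induction
  needs it when vertex \<open>m\<close> joins.\<close>

lemma score_parity_arcs:
  "score {..<m} parity_arcs i =
     (if m \<le> i then (if even i then (m + 1) div 2 else m div 2)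
      else (if even i then m div 2 else (m + 1) div 2 - 1))"
proof (induction m)
  case (Suc m)
  have "{j \<in> {..<Suc m}. (i, j) \<in> parity_arcs} =
      {j \<in> {..<m}. (i, j) \<in> parity_arcs} \<union> (if (i, m) \<in> parity_arcs then {m} else {})"
    by (auto simp: less_Suc_eq)
  then have "score {..<Suc m} parity_arcs i =
      score {..<m} parity_arcs i + (if (i, m) \<in> parity_arcs then 1 else 0)"
    by (simp add: score_def)
  then show ?case unfolding Suc.IH by (auto simp: parity_arcs_def elim!: evenE oddE)
qed (simp add: score_def)

lemma balanced_parity_arcs: "balanced {..<m} parity_arcs"
proof -
  have "\<bar>deviation {..<m} parity_arcs i\<bar> \<le> 1" if "i < m" for i
    using that by (cases "even m"; cases "even i")
      (auto simp: deviation_def score_parity_arcs elim!: evenE oddE)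
  then show ?thesis by (simp add: balanced_def)
qed

text \<open>The source has the last label, so that the other vertices form the segment
  \<open>{..<n - 1}\<close>.\<close>

definition source_over_balanced :: "nat \<Rightarrow> real mat" where
  "source_over_balanced n = mat n n (\<lambda>(i, j).
     if i \<noteq> j \<and> i = n - 1 \<or> j \<noteq> n - 1 \<and> (i, j) \<in> parity_arcs then 1 else 0)"

text \<open>Nothing beats a source, so its column is zero and its unit vector lies in the
  kernel.\<close>

lemma source_over_balanced_singular:
  assumes "0 < n"
  shows "source_over_balanced n \<in> singular_tournament_mats n"
proof -
  let ?M = "source_over_balanced n"
  have c: "?M \<in> carrier_mat n n" by (simp add: source_over_balanced_def)
  have "?M \<in> tournament_mats n"
  proof (rule tournament_matsI[OF c])
    fix i j assume ij: "i < n" "j < n"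
    show "?M $$ (i, j) \<in> {0, 1}" using ij by (simp add: source_over_balanced_def)
    show "?M $$ (i, j) + ?M $$ (j, i) = (if i = j then 0 else 1)"
    proof (cases "i = j")
      case False
      then have "(i, j) \<in> parity_arcs \<longleftrightarrow> (j, i) \<notin> parity_arcs"
        using tournament_onD(3)[OF tournament_on_parity_arcs[of "{i, j}"]] by blast
      then show ?thesis using ij False
        by (cases "(j, i) \<in> parity_arcs") (auto simp: source_over_balanced_def)
    qed (use ij in \<open>auto simp: source_over_balanced_def parity_arcs_def\<close>)
  qed
  moreover have "?M *\<^sub>v unit_vec n (n - 1) = 0\<^sub>v n"
    using assms c by (intro eq_vecI) (auto simp: source_over_balanced_def parity_arcs_def)
  then have "det ?M = 0"
    using assms c by (subst det_0_iff_vec_prod_zero[OF c]) (auto intro!: exI[of _ "unit_vec n (n - 1)"])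
  ultimately show ?thesis by (simp add: singular_tournament_mats_def)
qed

section \<open>Cyclic triples of singular maximizers\<close>

lemma C3_eq_card_cyclic_triples:
  assumes "M \<in> tournament_mats n"
  shows "C3 M = card (cyclic_triples {..<n} (arcs M))"
  by (simp add: C3_def cyclic_triples_def dim_row_tournament_mats[OF assms])

text \<open>The hypothesis says that \<open>v\<close> lies on no 3-cycle;
  \<open>card {x, y, z} \<noteq> 3\<close> also admits closed walks with repeated vertices.\<close>

lemma cyclic_triples_remove:
  assumes "\<And>x y z. x \<in> V \<Longrightarrow> y \<in> V \<Longrightarrow> z \<in> V \<Longrightarrow> (x, y) \<in> E \<Longrightarrow> (y, z) \<in> E \<Longrightarrow> (z, x) \<in> E \<Longrightarrow>
    v \<in> {x, y, z} \<Longrightarrow> card {x, y, z} \<noteq> 3"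
  shows "cyclic_triples V E = cyclic_triples (V - {v}) E"
proof (intro equalityI subsetI)
  fix S assume S: "S \<in> cyclic_triples V E"
  then obtain x y z where "S = {x, y, z}" "(x, y) \<in> E" "(y, z) \<in> E" "(z, x) \<in> E" "S \<subseteq> V" "card S = 3"
    unfolding cyclic_triples_def by blast
  then have "v \<notin> S" using assms[of x y z] by blast
  then show "S \<in> cyclic_triples (V - {v}) E" using S by (auto simp: cyclic_triples_def)
qed (auto simp: cyclic_triples_def)

lemma C3_source_over_balanced:
  assumes "0 < n"
  shows "C3 (source_over_balanced n) = card (cyclic_triples {..<n - 1} parity_arcs)"
proof -
  let ?M = "source_over_balanced n"
  have T: "?M \<in> tournament_mats n"
    using source_over_balanced_singular[OF assms] by (simp add: singular_tournament_mats_def)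
  have V: "{..<n} - {n - 1} = {..<n - 1}" using assms by auto
  have no: "(u, n - 1) \<notin> arcs ?M" for u
    unfolding arcs_tournament_mats[OF T] by (auto simp: source_over_balanced_def)
  have "C3 ?M = card (cyclic_triples {..<n - 1} (arcs ?M))"
    unfolding C3_eq_card_cyclic_triples[OF T] V[symmetric]
    by (subst cyclic_triples_remove[of _ _ "n - 1"]) (use no in auto)
  also have "cyclic_triples {..<n - 1} (arcs ?M) = cyclic_triples {..<n - 1} parity_arcs"
  proof -
    have a: "(i, j) \<in> arcs ?M \<longleftrightarrow> (i, j) \<in> parity_arcs" if "i < n - 1" "j < n - 1" for i j
      unfolding arcs_tournament_mats[OF T] using that by (auto simp: source_over_balanced_def)
    show ?thesis unfolding cyclic_triples_def
      by (intro Collect_cong conj_cong refl ex_cong1) (simp_all add: a)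
  qed
  finally show ?thesis .
qed

text \<open>\<open>Max\<close> bounds its arguments only over a finite set. Finiteness of the values
  follows from bounding \<open>C3\<close> by the number of vertex subsets, without counting
  matrices.\<close>

lemma C3_singular_maximizer_ge:
  assumes "singular_maximizer n M" "N \<in> singular_tournament_mats n"
  shows "C3 N \<le> C3 M"
proof -
  have "C3 N' \<le> card (Pow {..<n})" if "N' \<in> singular_tournament_mats n" for N'
  proof -
    have "N' \<in> tournament_mats n" using that by (simp add: singular_tournament_mats_def)
    then show ?thesis
      by (simp only: C3_eq_card_cyclic_triples) (rule card_mono, auto simp: cyclic_triples_def)
  qed
  then have "C3 ` singular_tournament_mats n \<subseteq> {..card (Pow {..<n})}" by blast
  then have "finite (C3 ` singular_tournament_mats n)" using finite_atMost by (rule finite_subset)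
  then show ?thesis using assms by (simp add: singular_maximizer_def)
qed

section \<open>Singleton strong components\<close>

lemma singleton_component_imp_balanced:
  assumes max: "singular_maximizer n M" and C: "C \<in> strong_components M" "card C = 1"
  shows "\<exists>v<n. balanced ({..<n} - {v}) (arcs M)"
proof -
  let ?r = "mutually_reachable M"
  have M: "M \<in> tournament_mats n"
    using max by (simp add: singular_maximizer_def singular_tournament_mats_def)
  have dim: "dim_row M = n" using M by (rule dim_row_tournament_mats)
  obtain v where v: "v < n" "C = ?r `` {v}"
    using C(1) by (auto simp: strong_components_def dim elim!: quotientE)
  then have "v \<in> C" by (simp add: mutually_reachable_def dim)
  then have single: "u = v" if "(v, u) \<in> ?r" for u
    using C(2) v(2) that by (metis ImageI card_1_singletonE singletonD singletonI)
  have notri: "card {x, y, z} \<noteq> 3"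
    if "x \<in> {..<n}" "y \<in> {..<n}" "z \<in> {..<n}"
      "(x, y) \<in> arcs M" "(y, z) \<in> arcs M" "(z, x) \<in> arcs M" "v \<in> {x, y, z}" for x y z
  proof -
    \<comment> \<open>The vertices of a closed walk reach each other, so a walk through
      \<open>v\<close> stays in its component and collapses to \<open>v\<close>.\<close>
    have st: "(a, b) \<in> (arcs M)\<^sup>*" if "a \<in> {x, y, z}" "b \<in> {x, y, z}" for a b
      using that \<open>(x, y) \<in> arcs M\<close> \<open>(y, z) \<in> arcs M\<close> \<open>(z, x) \<in> arcs M\<close>
      by (auto intro: rtrancl_trans r_into_rtrancl)
    have "(v, a) \<in> ?r" if "a \<in> {x, y, z}" for a
      using st[of v a] st[of a v] that \<open>v \<in> {x, y, z}\<close> \<open>x \<in> _\<close> \<open>y \<in> _\<close> \<open>z \<in> _\<close>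
      unfolding mutually_reachable_def dim by blast
    then have "x = v" "y = v" "z = v" using single by blast+
    then show ?thesis by simp
  qed
  have n: "0 < n" using v by simp
  have "cyclic_triples {..<n} (arcs M) = cyclic_triples ({..<n} - {v}) (arcs M)"
    using notri by (rule cyclic_triples_remove)
  then have "C3 M = card (cyclic_triples ({..<n} - {v}) (arcs M))"
    by (simp only: C3_eq_card_cyclic_triples[OF M])
  \<comment> \<open>Maximality of \<open>M\<close> is tested against
    \<open>source_over_balanced n\<close>.\<close>
  moreover have "card (cyclic_triples {..<n - 1} parity_arcs) \<le> C3 M"
    using C3_singular_maximizer_ge[OF max source_over_balanced_singular[OF n]] C3_source_over_balanced[OF n]
    by simp
  ultimately have le: "card (cyclic_triples {..<n - 1} parity_arcs)
      \<le> card (cyclic_triples ({..<n} - {v}) (arcs M))" by simp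
  have "tournament_on ({..<n} - {v}) (arcs M)"
    using tournament_on_arcs[OF M] by (rule tournament_on_subset) simp
  then have "balanced ({..<n} - {v}) (arcs M)"
    using tournament_on_parity_arcs[OF finite_lessThan] balanced_parity_arcs _ le
    by (rule balanced_if_cyclic_triples_ge) (use v in simp)
  then show ?thesis using v by blast
qed

text \<open>No arc enters a source and none leaves a sink, so of two walks joining \<open>v\<close>
  to \<open>u\<close> and back, one has to be empty.\<close>

lemma source_or_sink_imp_singleton_component:
  assumes M: "M \<in> tournament_mats n" and v: "v < n" "is_source M v \<or> is_sink M v"
  shows "\<exists>C\<in>strong_components M. card C = 1"
proof -
  have dim: "dim_row M = n" using M by (rule dim_row_tournament_mats)
  have tot: "(u, v) \<notin> arcs M \<or> (v, u) \<notin> arcs M" for u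
    using tournament_onD(2,3)[OF tournament_on_arcs[OF M]] v arcs_tournament_mats[OF M]
    by (metis lessThan_iff)
  have "(\<forall>u. (u, v) \<notin> arcs M) \<or> (\<forall>u. (v, u) \<notin> arcs M)"
    using v(2) tot arcs_tournament_mats[OF M] unfolding is_source_def is_sink_def dim by metis
  then have "u = v" if "(v, u) \<in> (arcs M)\<^sup>*" "(u, v) \<in> (arcs M)\<^sup>*" for u
    using that
    by (elim disjE) (erule rtranclE[of u v], blast+, erule converse_rtranclE[of v u], blast+)
  then have "mutually_reachable M `` {v} = {v}"
    using v by (auto simp: mutually_reachable_def dim)
  moreover have "mutually_reachable M `` {v} \<in> strong_components M"
    unfolding strong_components_def using v dim by (intro quotientI) auto
  ultimately show ?thesis by (intro bexI[of _ "{v}"]) auto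
qed

theorem theorem2p7:
  fixes n :: nat and M :: "real mat"
  assumes "M \<in> singular_tournament_mats n" and "singular_maximizer n M"
  shows "(trivial_singular_maximizer n M \<longleftrightarrow>
           (\<exists>N v. (regular_tournament (n - 1) N \<or> almost_regular_tournament (n - 1) N) \<and>
              obtained_by_adding_vertex n M v N \<and> (is_source M v \<or> is_sink M v))) \<and>
         ((\<exists>N v. (regular_tournament (n - 1) N \<or> almost_regular_tournament (n - 1) N) \<and>
              obtained_by_adding_vertex n M v N \<and> (is_source M v \<or> is_sink M v)) \<longleftrightarrow>
           (\<exists>C \<in> strong_components M. card C = 1))"
proof -
  have M: "M \<in> tournament_mats n" using assms(1) by (simp add: singular_tournament_mats_def)
  note iff = added_to_regular_or_almost_regular_iff[OF M]
  have i: "trivial_singular_maximizer n M \<longleftrightarrow> (\<exists>v<n. balanced ({..<n} - {v}) (arcs M))"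
    unfolding trivial_singular_maximizer_def iff using assms(2) by blast
  have ii: "(\<exists>N v. (regular_tournament (n - 1) N \<or> almost_regular_tournament (n - 1) N) \<and>
        obtained_by_adding_vertex n M v N \<and> (is_source M v \<or> is_sink M v)) \<longleftrightarrow>
      (\<exists>v<n. balanced ({..<n} - {v}) (arcs M) \<and> (is_source M v \<or> is_sink M v))"
    unfolding conj_assoc[symmetric] iff by blast
  \<comment> \<open>The three lemmas give (i) to (ii), (iii) to (i) and (ii) to (iii), which closes
    the circle.\<close>
  show ?thesis
    unfolding i ii
    using singular_trivial_imp_source_or_sink[OF assms(1)]
      singleton_component_imp_balanced[OF assms(2)] source_or_sink_imp_singleton_component[OF M]
    by blast
qed

end
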